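(* Let $C\subset[0,1]$ be the middle third Cantor set, let $C\times C\subset\mathbb{R}^2$ be its Cartesian product with itself, and let $s=\dim_H(C\times C)=\log_3 4$. Then the $s$-dimensional Hausdorff measure of $C\times C$ satisfies $$H^s(C\times C)\le 1.502878.$$
   Context: The middle third Cantor set $C$ is the unique nonempty compact set with $C=f_1(C)\cup f_2(C)$, where $f_1(x)=x/3$ and $f_2(x)=(x+2)/3$. The plane $\mathbb{R}^2$ carries the Euclidean metric and $|U|$ denotes the diameter of a set $U$. Hausdorff measure is taken without any normalizing constant: for $\delta>0$, $H^s_\delta(E)=\inf\sum_{i=1}^\infty |U_i|^s$, the infimum being over all countable covers $E\subset\bigcup_i U_i$ with $0<|U_i|\le\delta$, and $H^s(E)=\lim_{\delta\to0^+}H^s_\delta(E)$. *)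

theory Defs
  imports "HOL-Analysis.Analysis"
begin

section \<open>Hausdorff measure and dimension\<close>

text \<open>
  The covering sets are required to be bounded because \<^const>\<open>diameter\<close> is a real number whose
  value on an unbounded set is unspecified; a set of infinite diameter is never admissible.
  As every covering set has positive diameter and the covers are infinite sequences, the values
  are the usual ones for \<open>s > 0\<close> in spaces with sets of arbitrarily small positive diameter
  (a finite cover can be padded by sets of negligible total cost); for \<open>s = 0\<close> one does not
  obtain the counting measure. No normalizing constant is used.
\<close>

definition delta_cover :: "real \<Rightarrow> 'a::metric_space set \<Rightarrow> (nat \<Rightarrow> 'a set) \<Rightarrow> bool" where
  "delta_cover \<delta> E U \<longleftrightarrow>
     E \<subseteq> (\<Union>i. U i) \<and> (\<forall>i. bounded (U i) \<and> 0 < diameter (U i) \<and> diameter (U i) \<le> \<delta>)"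

definition hausdorff_pre_measure :: "real \<Rightarrow> real \<Rightarrow> 'a::metric_space set \<Rightarrow> ennreal" where
  "hausdorff_pre_measure s \<delta> E =
     (INF U \<in> {U. delta_cover \<delta> E U}. \<Sum>i. ennreal (diameter (U i) powr s))"

definition hausdorff_measure :: "real \<Rightarrow> 'a::metric_space set \<Rightarrow> ennreal" where
  "hausdorff_measure s E = Lim (at_right 0) (\<lambda>\<delta>. hausdorff_pre_measure s \<delta> E)"

definition hausdorff_dim :: "'a::metric_space set \<Rightarrow> ereal" where
  "hausdorff_dim E = (INF s \<in> {s. 0 \<le> s \<and> hausdorff_measure s E = 0}. ereal s)"

text \<open>The limit exists, by monotonicity in \<open>\<delta>\<close>.\<close>

lemma hausdorff_pre_measure_antimono:
  assumes "\<delta> \<le> \<epsilon>"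
  shows "hausdorff_pre_measure s \<epsilon> E \<le> hausdorff_pre_measure s \<delta> E"
proof -
  have "delta_cover \<epsilon> E U" if "delta_cover \<delta> E U" for U
    using that assms unfolding delta_cover_def by (meson order_trans)
  then show ?thesis
    unfolding hausdorff_pre_measure_def by (intro INF_superset_mono) auto
qed

lemma tendsto_hausdorff_pre_measure_SUP:
  "((\<lambda>\<delta>. hausdorff_pre_measure s \<delta> E) \<longlongrightarrow> (SUP \<delta>\<in>{0<..}. hausdorff_pre_measure s \<delta> E)) (at_right 0)"
proof (rule increasing_tendsto)
  show "\<forall>\<^sub>F \<delta> in at_right 0. hausdorff_pre_measure s \<delta> E \<le> (SUP \<delta>\<in>{0<..}. hausdorff_pre_measure s \<delta> E)"
    by (auto simp: eventually_at_right_less intro!: SUP_upper eventually_mono[OF eventually_at_right_less[of 0]])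
next
  fix x assume "x < (SUP \<delta>\<in>{0<..}. hausdorff_pre_measure s \<delta> E)"
  then obtain e :: real where e: "0 < e" "x < hausdorff_pre_measure s e E"
    by (auto simp: less_SUP_iff)
  have "\<forall>\<^sub>F \<delta> in at_right 0. \<delta> < e"
    using e(1) eventually_at_right_field by blast
  then show "\<forall>\<^sub>F \<delta> in at_right 0. x < hausdorff_pre_measure s \<delta> E"
    by eventually_elim
      (meson e(2) hausdorff_pre_measure_antimono less_imp_le order_less_le_trans)
qed

lemma hausdorff_measure_eq_SUP:
  "hausdorff_measure s E = (SUP \<delta>\<in>{0<..}. hausdorff_pre_measure s \<delta> E)"
  unfolding hausdorff_measure_def
  by (rule tendsto_Lim[OF _ tendsto_hausdorff_pre_measure_SUP]) simp

lemma tendsto_hausdorff_measure: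
  "((\<lambda>\<delta>. hausdorff_pre_measure s \<delta> E) \<longlongrightarrow> hausdorff_measure s E) (at_right 0)"
  unfolding hausdorff_measure_eq_SUP by (rule tendsto_hausdorff_pre_measure_SUP)


section \<open>The middle third Cantor set\<close>

definition is_cantor_attractor :: "real set \<Rightarrow> bool" where
  "is_cantor_attractor C \<longleftrightarrow>
     C \<noteq> {} \<and> compact C \<and> C = (\<lambda>x. x / 3) ` C \<union> (\<lambda>x. (x + 2) / 3) ` C"

definition cantor_set :: "real set" where
  "cantor_set = (THE C. is_cantor_attractor C)"

lemma is_cantor_attractor_subset:
  assumes A: "is_cantor_attractor A" and B: "is_cantor_attractor B"
  shows "A \<subseteq> B"
proof -
  have "compact A" "A \<noteq> {}" "B \<noteq> {}" "closed B"
    using A B by (auto simp: is_cantor_attractor_def compact_imp_closed)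
  have "\<exists>x\<in>A. \<forall>y\<in>A. infdist y B \<le> infdist x B"
    by (rule continuous_attains_sup[OF \<open>compact A\<close> \<open>A \<noteq> {}\<close>]) (intro continuous_intros)
  then obtain x where x: "x \<in> A" "\<And>y. y \<in> A \<Longrightarrow> infdist y B \<le> infdist x B"
    by blast
  have "x \<in> (\<lambda>x. x / 3) ` A \<union> (\<lambda>x. (x + 2) / 3) ` A"
    using A x(1) by (auto simp: is_cantor_attractor_def)
  then obtain y c where y: "y \<in> A" "x = (y + c) / 3" "c = 0 \<or> c = 2"
    by fastforce
  obtain z where z: "z \<in> B" "infdist y B = dist y z"
    using infdist_attains_inf[OF \<open>closed B\<close> \<open>B \<noteq> {}\<close>] by blast
  have "(z + c) / 3 \<in> (\<lambda>x. x / 3) ` B \<union> (\<lambda>x. (x + 2) / 3) ` B"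
    using z(1) y(3) by auto
  then have "(z + c) / 3 \<in> B"
    using B by (auto simp: is_cantor_attractor_def)
  then have "infdist x B \<le> dist x ((z + c) / 3)"
    by (rule infdist_le)
  also have "\<dots> = dist y z / 3"
    by (simp add: y(2) dist_real_def flip: diff_divide_distrib)
  also have "\<dots> \<le> infdist x B / 3"
    using x(2)[OF y(1)] z(2) by simp
  finally have "infdist x B = 0"
    using infdist_nonneg[of x B] by linarith
  then have "infdist y B = 0" if "y \<in> A" for y
    using x(2)[OF that] infdist_nonneg[of y B] by linarith
  then show ?thesis
    using in_closed_iff_infdist_zero[OF \<open>closed B\<close> \<open>B \<noteq> {}\<close>] by blast
qed

lemma ex_is_cantor_attractor: "\<exists>C. is_cantor_attractor C"
proof -
  define F :: "real set \<Rightarrow> real set"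
    where "F = (\<lambda>S. (\<lambda>x. x / 3) ` S \<union> (\<lambda>x. (x + 2) / 3) ` S)"
  define K where "K n = (F ^^ n) {0..1}" for n
  have K0: "K 0 = {0..1}" and KS: "K (Suc n) = F (K n)" for n
    by (simp_all add: K_def)
  have cpt: "compact (K n)" for n
  proof (induction n)
    case (Suc n)
    then show ?case
      unfolding KS F_def
      by (intro compact_Un compact_continuous_image continuous_intros) auto
  qed (simp add: K0)
  have zero: "0 \<in> K n" for n
  proof (induction n)
    case (Suc n)
    then show ?case unfolding KS F_def by (auto intro!: image_eqI[where x = 0])
  qed (simp add: K0)
  have K01: "K n \<subseteq> {0..1}" for n
  proof (induction n)
    case (Suc n)
    then show ?case unfolding KS F_def by force
  qed (simp add: K0)
  have decr: "K (Suc n) \<subseteq> K n" for n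
  proof (induction n)
    case 0
    show ?case using K01[of "Suc 0"] by (simp add: K0)
  next
    case (Suc n)
    then show ?case unfolding KS[of "Suc n"] KS[of n] F_def by blast
  qed
  let ?C = "\<Inter>n. K n"
  have "?C \<subseteq> F ?C"
  proof
    fix x assume x: "x \<in> ?C"
    then have xF: "x \<in> F (K n)" for n
      using KS[of n] by blast
    show "x \<in> F ?C"
    proof (cases "x \<le> 1/3")
      case True
      have "3 * x \<in> K n" for n
        using xF[of n] True K01[of n] unfolding F_def by force
      then show ?thesis
        unfolding F_def by (intro UnI1 image_eqI[where x = "3 * x"]) auto
    next
      case False
      have "3 * x - 2 \<in> K n" for n
      proof -
        obtain y where "y \<in> K n" "x = y / 3 \<or> x = (y + 2) / 3"
          using xF[of n] unfolding F_def by blast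
        moreover have "y \<le> 1"
          using K01[of n] \<open>y \<in> K n\<close> by auto
        ultimately show ?thesis
          using False by (auto simp: field_simps)
      qed
      then show ?thesis
        unfolding F_def by (intro UnI2 image_eqI[where x = "3 * x - 2"]) auto
    qed
  qed
  moreover have "F ?C \<subseteq> ?C"
  proof -
    have "F ?C \<subseteq> K n" for n
    proof -
      have "F ?C \<subseteq> F (K n)"
        unfolding F_def by blast
      then show ?thesis
        using KS[of n] decr[of n] by blast
    qed
    then show ?thesis by blast
  qed
  moreover have "compact ?C"
    by (rule compact_Inter) (use cpt in auto)
  ultimately have "is_cantor_attractor ?C"
    using zero unfolding is_cantor_attractor_def F_def by blast
  then show ?thesis by blast
qed

lemma ex1_is_cantor_attractor: "\<exists>!C. is_cantor_attractor C"
  using ex_is_cantor_attractor is_cantor_attractor_subset by (metis subset_antisym)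

lemma is_cantor_attractor_cantor_set: "is_cantor_attractor cantor_set"
  unfolding cantor_set_def by (rule theI'[OF ex1_is_cantor_attractor])

end

theory Submission
  imports Defs
begin

text \<open>
  Let \<open>E\<close> be the product of the Cantor set with itself and \<open>s = log 3 4\<close>. As \<open>E\<close> is a union of
  four copies of itself scaled by \<open>1/3\<close>, and \<open>4 * (1/3) powr s = 1\<close>, any cover can be replaced
  at no extra cost by one with sets three times smaller. Hence the \<open>s\<close>-dimensional pre-measure of \<open>E\<close>
  takes the same value \<open>h\<close> for all \<open>\<delta> > 0\<close>, and \<open>h\<close> is the Hausdorff measure
  (\<open>hausdorff_measure_cantor_dust\<close>). In particular, covers by large sets suffice for upper bounds.

  Upper bound. Let one set \<open>U\<close> of diameter \<open>d\<close> cover all of \<open>E\<close> except for cylinders (scaled copies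
  of \<open>E\<close>) of total natural mass \<open>m\<close>, where a cylinder of level \<open>n\<close> has mass \<open>1 / 4 ^ n\<close>. Covering
  these cylinders optimally costs \<open>m * h\<close>, so \<open>h \<le> d powr s + m * h\<close>, that is,
  \<open>h \<le> d powr s / (1 - m)\<close>. The unit square itself gives only \<open>sqrt 2 powr s > 1.548\<close>. It pays to
  cut off its corners: the longest distances run between opposite corners, where there is
  little mass. Cutting off the right triangles with legs \<open>a = 20/243\<close> at the corners yields an
  octagon with \<open>d\<^sup>2 = 1 + (1 - 2 * a)\<^sup>2\<close> (\<open>dist_cut_square_le\<close>). The value of \<open>a\<close> is chosen at the end
  of a gap of \<open>E\<close>: each corner loses exactly one cylinder of level 3 and two of level 5
  (\<open>cantor_dust_decomposition\<close>), so \<open>m = 4/64 + 8/1024 = 9/128\<close>. Since \<open>2 ^ 19 < 3 ^ 12\<close> gives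
  \<open>log 3 2 < 12/19\<close>, one gets \<open>d powr s = (d\<^sup>2) powr log 3 2 \<le> 1.3972\<close>, and
  \<open>1.3972 * 128/119 < 1.502878\<close>.

  Dimension. It remains to see that \<open>h > 0\<close>, since an exponent with positive and finite measure is the
  dimension (\<open>hausdorff_dim_eqI\<close>). The Cantor function maps the Cantor set onto the unit interval and is
  Hoelder continuous with exponent \<open>s / 2\<close>, so it turns a cover of \<open>E\<close> into a cover of the unit square
  whose total area is at most \<open>16\<close> times the cost of the cover. The formal proof works with a right
  inverse of the Cantor function (\<open>cantor_inverse_expands\<close>), whose values are explicit series, and gives
  \<open>h \<ge> 1/16\<close> (\<open>hausdorff_pre_measure_cantor_dust_ge\<close>).
\<close>

section \<open>Hausdorff pre-measures\<close>

lemma hausdorff_pre_measure_le_cover: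
  assumes "delta_cover \<delta> E U"
  shows "hausdorff_pre_measure s \<delta> E \<le> (\<Sum>i. ennreal (diameter (U i) powr s))"
  unfolding hausdorff_pre_measure_def using assms by (intro INF_lower) simp

text \<open>
  Multiplication by a positive real is an order isomorphism of the extended nonnegative reals, so it
  commutes with the infimum over covers.
\<close>

lemma le_cmult_hausdorff_pre_measureI:
  assumes "0 < c"
    and "\<And>U. delta_cover \<delta> E U \<Longrightarrow> x \<le> ennreal c * (\<Sum>i. ennreal (diameter (U i) powr s))"
  shows "x \<le> ennreal c * hausdorff_pre_measure s \<delta> E"
proof -
  have cc: "ennreal (1 / c) * (ennreal c * y) = y" "ennreal c * (ennreal (1 / c) * y) = y" for y
    using assms(1) by (simp_all add: mult.assoc[symmetric] ennreal_mult[symmetric])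
  have "ennreal (1 / c) * x \<le> hausdorff_pre_measure s \<delta> E"
    unfolding hausdorff_pre_measure_def
  proof (rule INF_greatest)
    fix U assume "U \<in> {U. delta_cover \<delta> E U}"
    then have "ennreal (1 / c) * x \<le> ennreal (1 / c) * (ennreal c * (\<Sum>i. ennreal (diameter (U i) powr s)))"
      using assms(2) by (intro mult_left_mono) auto
    then show "ennreal (1 / c) * x \<le> (\<Sum>i. ennreal (diameter (U i) powr s))"
      by (simp only: cc)
  qed
  then have "ennreal c * (ennreal (1 / c) * x) \<le> ennreal c * hausdorff_pre_measure s \<delta> E"
    by (intro mult_left_mono) auto
  then show ?thesis
    by (simp only: cc)
qed

lemma hausdorff_pre_measure_mono:
  assumes "A \<subseteq> B"
  shows "hausdorff_pre_measure s \<delta> A \<le> hausdorff_pre_measure s \<delta> B"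
proof -
  have "delta_cover \<delta> A U" if "delta_cover \<delta> B U" for U
    using that assms unfolding delta_cover_def by blast
  then show ?thesis
    unfolding hausdorff_pre_measure_def by (intro INF_superset_mono) auto
qed

lemma sum_interleave:
  fixes f g :: "nat \<Rightarrow> 'a::comm_monoid_add"
  shows "(\<Sum>i<2 * n. if even i then f (i div 2) else g (i div 2)) = (\<Sum>i<n. f i) + (\<Sum>i<n. g i)"
  by (induction n) (simp_all add: ac_simps)

text \<open>
  A cover of \<open>A\<close> and a cover of \<open>B\<close> are interleaved into one sequence, the costs
  add up, and the infima are approximated up to \<open>e / 2\<close> each.
\<close>

lemma hausdorff_pre_measure_Un:
  "hausdorff_pre_measure s \<delta> (A \<union> B) \<le> hausdorff_pre_measure s \<delta> A + hausdorff_pre_measure s \<delta> B"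
proof -
  let ?S = "\<lambda>U. \<Sum>i. ennreal (diameter (U i) powr s)"
  have two: "hausdorff_pre_measure s \<delta> (A \<union> B) \<le> ?S U + ?S V"
    if U: "delta_cover \<delta> A U" and V: "delta_cover \<delta> B V" for U V
  proof -
    define W where "W i = (if even i then U (i div 2) else V (i div 2))" for i
    have "A \<union> B \<subseteq> (\<Union>i. W i)"
    proof
      fix x assume "x \<in> A \<union> B"
      then obtain i where "x \<in> U i \<or> x \<in> V i"
        using U V unfolding delta_cover_def by blast
      then have "x \<in> W (2 * i) \<or> x \<in> W (2 * i + 1)"
        by (simp add: W_def)
      then show "x \<in> (\<Union>i. W i)" by blast
    qed
    then have "delta_cover \<delta> (A \<union> B) W"
      using U V unfolding delta_cover_def W_def by simp
    then have "hausdorff_pre_measure s \<delta> (A \<union> B) \<le> ?S W"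
      by (rule hausdorff_pre_measure_le_cover)
    also have "\<dots> \<le> ?S U + ?S V"
    proof (rule suminf_le_const)
      fix n
      have "(\<Sum>i<n. ennreal (diameter (W i) powr s)) \<le> (\<Sum>i<2 * n. ennreal (diameter (W i) powr s))"
        by (intro sum_mono2) auto
      also have "\<dots> = (\<Sum>i<2 * n. if even i then ennreal (diameter (U (i div 2)) powr s)
          else ennreal (diameter (V (i div 2)) powr s))"
        by (intro sum.cong) (auto simp: W_def)
      also have "\<dots> = (\<Sum>i<n. ennreal (diameter (U i) powr s)) + (\<Sum>i<n. ennreal (diameter (V i) powr s))"
        by (rule sum_interleave)
      also have "\<dots> \<le> ?S U + ?S V"
        by (intro add_mono sum_le_suminf) auto
      finally show "(\<Sum>i<n. ennreal (diameter (W i) powr s)) \<le> ?S U + ?S V" .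
    qed simp
    finally show ?thesis .
  qed
  show ?thesis
  proof (rule ennreal_le_epsilon)
    fix e :: real
    assume fin: "hausdorff_pre_measure s \<delta> A + hausdorff_pre_measure s \<delta> B < top" and "0 < e"
    then have "hausdorff_pre_measure s \<delta> A < hausdorff_pre_measure s \<delta> A + ennreal (e / 2)"
      "hausdorff_pre_measure s \<delta> B < hausdorff_pre_measure s \<delta> B + ennreal (e / 2)"
      by (auto simp: ennreal_add_left_cancel_less[where b = 0, simplified])
    then obtain U V where U: "delta_cover \<delta> A U" "?S U < hausdorff_pre_measure s \<delta> A + ennreal (e / 2)"
      and V: "delta_cover \<delta> B V" "?S V < hausdorff_pre_measure s \<delta> B + ennreal (e / 2)"
      by (subst (asm) (1 3) hausdorff_pre_measure_def) (auto simp: INF_less_iff)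
    have "hausdorff_pre_measure s \<delta> (A \<union> B) \<le> ?S U + ?S V"
      using two U V by blast
    also have "\<dots> \<le> (hausdorff_pre_measure s \<delta> A + ennreal (e / 2)) + (hausdorff_pre_measure s \<delta> B + ennreal (e / 2))"
      using U V by (intro add_mono) auto
    also have "\<dots> = hausdorff_pre_measure s \<delta> A + hausdorff_pre_measure s \<delta> B + (ennreal (e / 2) + ennreal (e / 2))"
      by (simp add: ac_simps)
    also have "ennreal (e / 2) + ennreal (e / 2) = ennreal e"
      using \<open>0 < e\<close> by (simp flip: ennreal_plus)
    finally show "hausdorff_pre_measure s \<delta> (A \<union> B) \<le> hausdorff_pre_measure s \<delta> A + hausdorff_pre_measure s \<delta> B + ennreal e" .
  qed
qed

lemma hausdorff_pre_measure_UN: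
  assumes "finite I" "I \<noteq> {}"
  shows "hausdorff_pre_measure s \<delta> (\<Union>i\<in>I. A i) \<le> (\<Sum>i\<in>I. hausdorff_pre_measure s \<delta> (A i))"
  using assms
proof (induction I rule: finite_ne_induct)
  case (insert x F)
  have "hausdorff_pre_measure s \<delta> (A x \<union> (\<Union>i\<in>F. A i))
      \<le> hausdorff_pre_measure s \<delta> (A x) + hausdorff_pre_measure s \<delta> (\<Union>i\<in>F. A i)"
    by (rule hausdorff_pre_measure_Un)
  also have "\<dots> \<le> hausdorff_pre_measure s \<delta> (A x) + (\<Sum>i\<in>F. hausdorff_pre_measure s \<delta> (A i))"
    using insert.IH by (intro add_left_mono)
  finally show ?case
    using insert.hyps by simp
qed simp

text \<open>
  A one-element cover must be padded to an infinite sequence of sets of positive diameter; balls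
  whose diameters to the power \<open>s\<close> form a geometric series cost at most any prescribed \<open>e\<close>.
\<close>

lemma hausdorff_pre_measure_le_diameter:
  fixes A :: "'a::euclidean_space set"
  assumes "bounded A" "0 < diameter A" "diameter A \<le> \<delta>" "0 < s"
  shows "hausdorff_pre_measure s \<delta> A \<le> ennreal (diameter A powr s)"
proof (rule ennreal_le_epsilon)
  fix e :: real assume "0 < e"
  have "0 < \<delta>" using assms by linarith
  \<comment> \<open>The bound by \<open>\<delta> powr s\<close> keeps the diameters of the padding balls at most \<open>\<delta>\<close>.\<close>
  define \<eta> where "\<eta> = min e (\<delta> powr s)"
  have \<eta>: "0 < \<eta>" "\<eta> \<le> e" "\<eta> \<le> \<delta> powr s"
    using \<open>0 < e\<close> \<open>0 < \<delta>\<close> by (auto simp: \<eta>_def)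
  define r where "r i = (\<eta> * (1/2) ^ Suc i) powr (1 / s)" for i :: nat
  have r_pos: "0 < r i" for i
    using \<eta> by (simp add: r_def)
  have r_powr: "r i powr s = \<eta> * (1/2) ^ Suc i" for i
    using \<eta> assms(4) unfolding r_def by (simp add: powr_powr)
  have r_le: "r i \<le> \<delta>" for i
  proof -
    have "\<eta> * (1/2) ^ Suc i \<le> \<eta> * 1"
      using \<eta> by (intro mult_left_mono power_le_one) auto
    then have "\<eta> * (1/2) ^ Suc i \<le> \<delta> powr s"
      using \<eta> by linarith
    then have "r i \<le> (\<delta> powr s) powr (1 / s)"
      unfolding r_def using \<eta> assms(4) by (intro powr_mono2) auto
    then show ?thesis
      using assms(4) \<open>0 < \<delta>\<close> by (simp add: powr_powr)
  qed
  define U where "U i = (case i of 0 \<Rightarrow> A | Suc j \<Rightarrow> ball 0 (r j / 2))" for i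
  have U0: "U 0 = A" and US: "U (Suc j) = ball 0 (r j / 2)" for j
    by (simp_all add: U_def)
  have dS: "diameter (U (Suc j)) = r j" for j
    using r_pos[of j] by (simp add: US)
  have "bounded (U i) \<and> 0 < diameter (U i) \<and> diameter (U i) \<le> \<delta>" for i
  proof (cases i)
    case 0
    then show ?thesis using assms U0 by simp
  next
    case (Suc j)
    then show ?thesis using dS[of j] r_pos[of j] r_le[of j] by (simp add: US)
  qed
  then have "delta_cover \<delta> A U"
    using U0 unfolding delta_cover_def by blast
  then have "hausdorff_pre_measure s \<delta> A \<le> (\<Sum>i. ennreal (diameter (U i) powr s))"
    by (rule hausdorff_pre_measure_le_cover)
  also have "\<dots> = (\<Sum>i. ennreal (diameter (U (i + 1)) powr s)) + (\<Sum>i<1. ennreal (diameter (U i) powr s))"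
    by (rule suminf_offset) simp
  also have "\<dots> = (\<Sum>i. ennreal (diameter (U (Suc i)) powr s)) + ennreal (diameter A powr s)"
    by (simp add: U0)
  also have "(\<Sum>i. ennreal (diameter (U (Suc i)) powr s)) = (\<Sum>i. ennreal (\<eta> * (1/2) ^ Suc i))"
    by (simp only: dS r_powr)
  also have "\<dots> = ennreal \<eta>"
    using sums_mult[OF power_half_series, of \<eta>] \<eta> by (intro suminf_ennreal_eq) auto
  also have "ennreal \<eta> + ennreal (diameter A powr s) \<le> ennreal (diameter A powr s) + ennreal e"
    using \<eta> by (simp add: add.commute add_mono ennreal_leI)
  finally show "hausdorff_pre_measure s \<delta> A \<le> ennreal (diameter A powr s) + ennreal e" .
qed

lemma diameter_similarity:
  fixes f :: "'a::real_normed_vector \<Rightarrow> 'b::real_normed_vector"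
  assumes "0 < r" and f: "\<And>x y. dist (f x) (f y) = r * dist x y" and "bounded S"
  shows "bounded (f ` S)" "diameter (f ` S) = r * diameter S"
proof -
  have le: "dist (f x) (f y) \<le> r * diameter S" if "x \<in> S" "y \<in> S" for x y
    using diameter_bounded_bound[OF \<open>bounded S\<close> that] f \<open>0 < r\<close> by simp
  show b: "bounded (f ` S)"
    unfolding bounded_two_points using le by (auto intro!: exI[of _ "r * diameter S"])
  show "diameter (f ` S) = r * diameter S"
  proof (cases "S = {}")
    case False
    have "diameter (f ` S) \<le> r * diameter S"
      using False le by (intro diameter_le) (auto simp: dist_norm)
    moreover have "diameter S \<le> diameter (f ` S) / r"
    proof (intro diameter_le)
      fix x y :: 'a assume "x \<in> S" "y \<in> S"
      then have "r * dist x y \<le> diameter (f ` S)"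
        using diameter_bounded_bound[OF b, of "f x" "f y"] f by auto
      then show "norm (x - y) \<le> diameter (f ` S) / r"
        using \<open>0 < r\<close> by (simp add: dist_norm field_simps)
    qed (use False in auto)
    ultimately show ?thesis
      using \<open>0 < r\<close> by (simp add: field_simps)
  qed simp
qed

lemma hausdorff_pre_measure_similarity_le:
  fixes f :: "'a::real_normed_vector \<Rightarrow> 'b::real_normed_vector"
  assumes "0 < r" and f: "\<And>x y. dist (f x) (f y) = r * dist x y"
  shows "hausdorff_pre_measure s \<delta> (f ` E) \<le> ennreal (r powr s) * hausdorff_pre_measure s (\<delta> / r) E"
proof (rule le_cmult_hausdorff_pre_measureI)
  fix U assume U: "delta_cover (\<delta> / r) E U"
  have D: "bounded (f ` U i)" "diameter (f ` U i) = r * diameter (U i)" for i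
    using diameter_similarity[OF assms] U unfolding delta_cover_def by blast+
  have "f ` E \<subseteq> (\<Union>i. f ` U i)"
    using U unfolding delta_cover_def by blast
  moreover have "0 < diameter (f ` U i) \<and> diameter (f ` U i) \<le> \<delta>" for i
    using U \<open>0 < r\<close> unfolding delta_cover_def D by (simp add: field_simps)
  ultimately have "delta_cover \<delta> (f ` E) (\<lambda>i. f ` U i)"
    using D unfolding delta_cover_def by blast
  then have "hausdorff_pre_measure s \<delta> (f ` E) \<le> (\<Sum>i. ennreal (diameter (f ` U i) powr s))"
    by (rule hausdorff_pre_measure_le_cover)
  also have "\<dots> = (\<Sum>i. ennreal (r powr s) * ennreal (diameter (U i) powr s))"
  proof -
    have "0 \<le> diameter (U i)" for i
      using U unfolding delta_cover_def by (meson less_imp_le)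
    then show ?thesis
      using \<open>0 < r\<close> by (simp add: D powr_mult ennreal_mult)
  qed
  finally show "hausdorff_pre_measure s \<delta> (f ` E)
      \<le> ennreal (r powr s) * (\<Sum>i. ennreal (diameter (U i) powr s))"
    by simp
qed (use \<open>0 < r\<close> in simp)

text \<open>
  This comparison of exponents yields both halves of the change of behaviour at the dimension: with
  \<open>\<delta> \<rightarrow> 0\<close> it kills the measure above a finite exponent, and with \<open>\<delta>\<close> fixed it propagates
  vanishing upwards.
\<close>

lemma hausdorff_pre_measure_raise_exponent:
  assumes "s \<le> t" "0 < \<delta>"
  shows "hausdorff_pre_measure t \<delta> E \<le> ennreal (\<delta> powr (t - s)) * hausdorff_pre_measure s \<delta> E"
proof (rule le_cmult_hausdorff_pre_measureI)
  fix U assume U: "delta_cover \<delta> E U"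
  have "ennreal (diameter (U i) powr t) \<le> ennreal (\<delta> powr (t - s)) * ennreal (diameter (U i) powr s)" for i
  proof -
    have d: "0 < diameter (U i)" "diameter (U i) \<le> \<delta>"
      using U unfolding delta_cover_def by auto
    have "diameter (U i) powr t = diameter (U i) powr (t - s) * diameter (U i) powr s"
      by (simp flip: powr_add)
    also have "\<dots> \<le> \<delta> powr (t - s) * diameter (U i) powr s"
      using d assms by (intro mult_right_mono powr_mono2) auto
    finally show ?thesis
      by (simp add: ennreal_leI flip: ennreal_mult)
  qed
  then have "(\<Sum>i. ennreal (diameter (U i) powr t))
      \<le> (\<Sum>i. ennreal (\<delta> powr (t - s)) * ennreal (diameter (U i) powr s))"
    by (intro suminf_le) auto
  then show "hausdorff_pre_measure t \<delta> E
      \<le> ennreal (\<delta> powr (t - s)) * (\<Sum>i. ennreal (diameter (U i) powr s))"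
    using hausdorff_pre_measure_le_cover[OF U, of t] by simp
qed (use assms in simp)

lemma hausdorff_pre_measure_le_hausdorff_measure:
  "0 < \<delta> \<Longrightarrow> hausdorff_pre_measure s \<delta> E \<le> hausdorff_measure s E"
  unfolding hausdorff_measure_eq_SUP by (rule SUP_upper) simp

text \<open>
  An exponent at which the measure is neither zero nor infinite is the dimension, by the comparison
  of pre-measures at two exponents.
\<close>

lemma hausdorff_dim_eqI:
  fixes E :: "'a::metric_space set"
  assumes "0 \<le> s" and pos: "0 < hausdorff_measure s E" and fin: "hausdorff_measure s E < top"
  shows "hausdorff_dim E = ereal s"
proof (rule antisym)
  have above: "hausdorff_measure t E = 0" if "s < t" for t
  proof -
    have "((\<lambda>\<delta>. ennreal (\<delta> powr (t - s)) * hausdorff_measure s E) \<longlongrightarrow> ennreal 0 * hausdorff_measure s E) (at_right 0)"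
    proof (intro tendsto_mult_ennreal tendsto_const tendsto_ennrealI)
      show "((\<lambda>\<delta>::real. \<delta> powr (t - s)) \<longlongrightarrow> 0) (at_right 0)"
        using that tendsto_powr2[of "\<lambda>\<delta>. \<delta>" 0 "at_right 0" "\<lambda>_. t - s" "t - s"]
          eventually_mono[OF eventually_at_right_less[of "0::real"], of "\<lambda>x. 0 \<le> x"]
        by simp
    qed (use fin in auto)
    moreover have "\<forall>\<^sub>F \<delta> in at_right 0.
        hausdorff_pre_measure t \<delta> E \<le> ennreal (\<delta> powr (t - s)) * hausdorff_measure s E"
    proof (rule eventually_at_rightI[of 0 1])
      fix \<delta> :: real assume "\<delta> \<in> {0<..<1}"
      then have "0 < \<delta>" by simp
      have "hausdorff_pre_measure t \<delta> E \<le> ennreal (\<delta> powr (t - s)) * hausdorff_pre_measure s \<delta> E"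
        using that \<open>0 < \<delta>\<close> by (intro hausdorff_pre_measure_raise_exponent) auto
      also have "\<dots> \<le> ennreal (\<delta> powr (t - s)) * hausdorff_measure s E"
        using \<open>0 < \<delta>\<close> by (intro mult_left_mono hausdorff_pre_measure_le_hausdorff_measure) auto
      finally show "hausdorff_pre_measure t \<delta> E \<le> ennreal (\<delta> powr (t - s)) * hausdorff_measure s E" .
    qed simp
    ultimately have "hausdorff_measure t E \<le> ennreal 0 * hausdorff_measure s E"
      using tendsto_hausdorff_measure[of t E] by (intro tendsto_le[of "at_right 0"]) auto
    then show ?thesis by simp
  qed
  show "hausdorff_dim E \<le> ereal s"
  proof (rule ereal_le_epsilon2)
    fix e :: real assume "0 < e"
    then have "hausdorff_dim E \<le> ereal (s + e)"
      unfolding hausdorff_dim_def using above[of "s + e"] \<open>0 \<le> s\<close> by (intro INF_lower) auto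
    then show "hausdorff_dim E \<le> ereal s + ereal e" by simp
  qed
  have "s \<le> t" if "hausdorff_measure t E = 0" for t
  proof (rule ccontr)
    assume "\<not> s \<le> t"
    have "hausdorff_pre_measure s \<delta> E = 0" if "0 < \<delta>" for \<delta>
    proof -
      have "hausdorff_pre_measure t \<delta> E = 0"
        using hausdorff_pre_measure_le_hausdorff_measure[OF \<open>0 < \<delta>\<close>, of t E] \<open>hausdorff_measure t E = 0\<close> by simp
      then show ?thesis
        using hausdorff_pre_measure_raise_exponent[of t s \<delta> E] \<open>\<not> s \<le> t\<close> \<open>0 < \<delta>\<close> by simp
    qed
    then have "hausdorff_measure s E \<le> 0"
      unfolding hausdorff_measure_eq_SUP by (intro SUP_least) simp
    then show False using pos by simp
  qed
  then show "ereal s \<le> hausdorff_dim E"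
    unfolding hausdorff_dim_def by (intro INF_greatest) auto
qed

section \<open>Basic intervals of the Cantor set\<close>

lemma cantor_set_image: "cantor_set = (\<lambda>x. x / 3) ` cantor_set \<union> (\<lambda>x. (x + 2) / 3) ` cantor_set"
  and compact_cantor_set: "compact cantor_set"
  and cantor_set_nonempty: "cantor_set \<noteq> {}"
  using is_cantor_attractor_cantor_set unfolding is_cantor_attractor_def by blast+

lemma cantor_set_thirdI:
  assumes "x \<in> cantor_set"
  shows "x / 3 \<in> cantor_set" "(x + 2) / 3 \<in> cantor_set"
  using assms cantor_set_image by blast+

lemma cantor_setE:
  assumes "x \<in> cantor_set"
  obtains y where "y \<in> cantor_set" "x = y / 3 \<or> x = (y + 2) / 3"
  using assms cantor_set_image by blast

text \<open>
  The largest and the smallest point of the set are images of points of the set, and the fixed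
  points of the two contractions are \<open>0\<close> and \<open>1\<close>.
\<close>

lemma cantor_set_bounds:
  assumes "x \<in> cantor_set"
  shows "0 \<le> x" "x \<le> 1"
proof -
  obtain M where M: "M \<in> cantor_set" "\<And>y. y \<in> cantor_set \<Longrightarrow> y \<le> M"
    using compact_attains_sup[OF compact_cantor_set cantor_set_nonempty] by blast
  obtain m where m: "m \<in> cantor_set" "\<And>y. y \<in> cantor_set \<Longrightarrow> m \<le> y"
    using compact_attains_inf[OF compact_cantor_set cantor_set_nonempty] by blast
  obtain y where "y \<in> cantor_set" "M = y / 3 \<or> M = (y + 2) / 3"
    using M(1) by (rule cantor_setE)
  with M(2)[of y] have "M \<le> 1" by auto
  obtain z where "z \<in> cantor_set" "m = z / 3 \<or> m = (z + 2) / 3"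
    using m(1) by (rule cantor_setE)
  with m(2)[of z] have "0 \<le> m" by auto
  show "0 \<le> x" "x \<le> 1"
    using M(2)[OF assms] m(2)[OF assms] \<open>M \<le> 1\<close> \<open>0 \<le> m\<close> by linarith+
qed

lemma cantor_set_zoom:
  assumes "x \<in> cantor_set"
  shows "x \<le> 1/3 \<and> 3 * x \<in> cantor_set \<or> 2/3 \<le> x \<and> 3 * x - 2 \<in> cantor_set"
proof -
  obtain y where y: "y \<in> cantor_set" "x = y / 3 \<or> x = (y + 2) / 3"
    using assms by (rule cantor_setE)
  from y(2) show ?thesis
  proof
    assume "x = y / 3"
    then have "y = 3 * x" by simp
    then show ?thesis using y(1) cantor_set_bounds[OF y(1)] by simp
  next
    assume "x = (y + 2) / 3"
    then have "y = 3 * x - 2" by simp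
    then show ?thesis using y(1) cantor_set_bounds[OF y(1)] by simp
  qed
qed

text \<open>
  The reflected set satisfies the same fixed-point equation (the reflection swaps the two
  contractions), and the attractor is unique.
\<close>

lemma cantor_set_symmetric:
  assumes "x \<in> cantor_set"
  shows "1 - x \<in> cantor_set"
proof -
  let ?D = "(\<lambda>x. 1 - x) ` cantor_set"
  have "?D = (\<lambda>x. 1 - x) ` ((\<lambda>x. x / 3) ` cantor_set \<union> (\<lambda>x. (x + 2) / 3) ` cantor_set)"
    by (rule arg_cong[OF cantor_set_image])
  also have "\<dots> = (\<lambda>x. x / 3) ` ?D \<union> (\<lambda>x. (x + 2) / 3) ` ?D"
    by (simp add: image_Un image_image Un_commute field_simps)
  finally have "is_cantor_attractor ?D"
    unfolding is_cantor_attractor_def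
    using cantor_set_nonempty compact_cantor_set
    by (auto intro!: compact_continuous_image continuous_intros)
  then have "?D \<subseteq> cantor_set"
    by (rule is_cantor_attractor_subset[OF _ is_cantor_attractor_cantor_set])
  then show ?thesis using assms by blast
qed

lemma cantor_set_zoom_left:
  assumes "x \<in> cantor_set" "x < 2/3"
  shows "x \<le> 1/3" "3 * x \<in> cantor_set"
  using cantor_set_zoom[OF assms(1)] assms(2) by auto

text \<open>
  To the left of \<open>20/243\<close> lie only the basic interval \<open>[0, 1/27]\<close> and the first basic interval of
  length \<open>1/243\<close> inside \<open>[2/27, 1/9]\<close>: the next one starts exactly at \<open>20/243\<close>.
\<close>

lemma cantor_set_near_zero:
  assumes x: "x \<in> cantor_set" "x < 20/243"
  shows "27 * x \<in> cantor_set \<or> 2/27 \<le> x \<and> 243 * x - 18 \<in> cantor_set"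
proof -
  have "9 * x \<in> cantor_set"
    using cantor_set_zoom_left[OF x(1)] cantor_set_zoom_left[of "3 * x"] x(2) by simp
  from cantor_set_zoom[OF this] show ?thesis
  proof
    assume r: "2/3 \<le> 9 * x \<and> 3 * (9 * x) - 2 \<in> cantor_set"
    then have "3 * (27 * x - 2) \<in> cantor_set"
      using cantor_set_zoom_left[of "27 * x - 2"] x(2) by simp
    then have "3 * (81 * x - 6) \<in> cantor_set"
      using cantor_set_zoom_left[of "81 * x - 6"] x(2) by (simp add: algebra_simps)
    then show ?thesis using r by (simp add: algebra_simps)
  qed simp
qed

lemma cantor_set_very_near_zero:
  assumes x: "x \<in> cantor_set" "x < 2/243"
  shows "243 * x \<in> cantor_set"
proof -
  have "3 * x \<in> cantor_set" using cantor_set_zoom_left[OF x(1)] x(2) by simp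
  then have "9 * x \<in> cantor_set" using cantor_set_zoom_left[of "3 * x"] x(2) by simp
  then have "27 * x \<in> cantor_set" using cantor_set_zoom_left[of "9 * x"] x(2) by simp
  then have "81 * x \<in> cantor_set" using cantor_set_zoom_left[of "27 * x"] x(2) by simp
  then show ?thesis using cantor_set_zoom_left[of "81 * x"] x(2) by simp
qed

text \<open>
  The part of the product set strictly below the line \<open>x + y = 20/243\<close> lies in the corner square of
  level 3 and in two squares of level 5 on the sides: if \<open>x \<ge> 18/243\<close>, then \<open>y < 2/243\<close>, which leaves
  only the first basic interval of length \<open>1/243\<close> for \<open>y\<close>, and symmetrically.
\<close>

lemma cantor_corner:
  assumes "x \<in> cantor_set" "y \<in> cantor_set" "x + y < 20/243"
  shows "27 * x \<in> cantor_set \<and> 27 * y \<in> cantor_set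
    \<or> 243 * x - 18 \<in> cantor_set \<and> 243 * y \<in> cantor_set
    \<or> 243 * x \<in> cantor_set \<and> 243 * y - 18 \<in> cantor_set"
proof -
  have pos: "0 \<le> x" "0 \<le> y"
    using assms cantor_set_bounds by auto
  then have "27 * x \<in> cantor_set \<or> 2/27 \<le> x \<and> 243 * x - 18 \<in> cantor_set"
    "27 * y \<in> cantor_set \<or> 2/27 \<le> y \<and> 243 * y - 18 \<in> cantor_set"
    using assms cantor_set_near_zero[of x] cantor_set_near_zero[of y] by linarith+
  moreover have "243 * y \<in> cantor_set" if "2/27 \<le> x"
    using that assms by (intro cantor_set_very_near_zero) auto
  moreover have "243 * x \<in> cantor_set" if "2/27 \<le> y"
    using that assms by (intro cantor_set_very_near_zero) auto
  ultimately show ?thesis by blast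
qed

section \<open>Self-similarity of the product\<close>

abbreviation "cantor_dust \<equiv> cantor_set \<times> cantor_set"

text \<open>
  The copy of the product set in the square of side \<open>1 / 3 ^ n\<close> with lower left corner \<open>v\<close>. The
  definition admits every \<open>v\<close>, since covering estimates do not depend on where the copy lies.
\<close>

definition cylinder :: "nat \<Rightarrow> real \<times> real \<Rightarrow> (real \<times> real) set" where
  "cylinder n v = (\<lambda>z. v + (1 / 3 ^ n) *\<^sub>R z) ` cantor_dust"

lemma mem_cylinderI:
  assumes "3 ^ n * (x - a) \<in> cantor_set" "3 ^ n * (y - b) \<in> cantor_set"
  shows "(x, y) \<in> cylinder n (a, b)"
  unfolding cylinder_def
  by (rule image_eqI[where x = "(3 ^ n * (x - a), 3 ^ n * (y - b))"]) (use assms in auto)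

text \<open>
  The exponent \<open>log 3 4\<close> is the one for which a contraction by \<open>1/3\<close> divides the cost of a cover
  by \<open>4\<close>, so the cost of a family of cylinders is governed by its share of the \<open>4 ^ n\<close> cylinders of
  level \<open>n\<close>.
\<close>

lemma hausdorff_pre_measure_UN_cylinders:
  assumes "finite V" "V \<noteq> {}"
  shows "hausdorff_pre_measure (log 3 4) \<delta> (\<Union>v\<in>V. cylinder n v)
    \<le> ennreal (card V / 4 ^ n) * hausdorff_pre_measure (log 3 4) (3 ^ n * \<delta>) cantor_dust"
proof -
  have "hausdorff_pre_measure (log 3 4) \<delta> (cylinder n v)
    \<le> ennreal (1 / 4 ^ n) * hausdorff_pre_measure (log 3 4) (3 ^ n * \<delta>) cantor_dust" for v
  proof -
    have "(1 / 3 ^ n) powr log 3 4 = (3 powr (- real n)) powr log 3 4"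
      by (simp add: powr_minus_divide powr_realpow)
    also have "\<dots> = (3 powr log 3 4) powr (- real n)"
      by (simp only: powr_powr mult.commute)
    finally have "(1 / 3 ^ n) powr log 3 4 = 1 / (4::real) ^ n"
      by (simp add: powr_minus_divide powr_realpow)
    moreover have "dist (v + (1 / 3 ^ n) *\<^sub>R x) (v + (1 / 3 ^ n) *\<^sub>R y) = 1 / 3 ^ n * dist x y"
      for x y :: "real \<times> real"
      by (simp add: dist_norm flip: scaleR_diff_right)
    ultimately show ?thesis
      using hausdorff_pre_measure_similarity_le[of "1 / 3 ^ n" "\<lambda>z. v + (1 / 3 ^ n) *\<^sub>R z" "log 3 4" \<delta> cantor_dust]
      by (simp add: cylinder_def mult.commute)
  qed
  then have "(\<Sum>v\<in>V. hausdorff_pre_measure (log 3 4) \<delta> (cylinder n v))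
      \<le> of_nat (card V) * (ennreal (1 / 4 ^ n) * hausdorff_pre_measure (log 3 4) (3 ^ n * \<delta>) cantor_dust)"
    by (intro sum_bounded_above) auto
  also have "\<dots> = ennreal (card V / 4 ^ n) * hausdorff_pre_measure (log 3 4) (3 ^ n * \<delta>) cantor_dust"
    by (simp add: mult.assoc[symmetric] ennreal_of_nat_eq_real_of_nat flip: ennreal_mult)
  finally show ?thesis
    using hausdorff_pre_measure_UN[OF assms] order_trans by blast
qed

lemma cantor_dust_subset_cylinders:
  "cantor_dust \<subseteq> (\<Union>v\<in>{0, 2/3} \<times> {0, 2/3}. cylinder 1 v)"
proof
  fix z assume "z \<in> cantor_dust"
  then obtain x y where z: "z = (x, y)" "x \<in> cantor_set" "y \<in> cantor_set" by blast
  have "\<exists>a\<in>{0, 2/3}. 3 * (x - a) \<in> cantor_set" if "x \<in> cantor_set" for x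
    using cantor_set_zoom[OF that] unfolding bex_simps by (auto simp: algebra_simps)
  with z obtain a b where "a \<in> {0, 2/3}" "b \<in> {0, 2/3}"
    "3 * (x - a) \<in> cantor_set" "3 * (y - b) \<in> cantor_set" by meson
  then have "(x, y) \<in> cylinder 1 (a, b)" "(a, b) \<in> {0, 2/3} \<times> {0, 2/3}"
    by (auto intro!: mem_cylinderI)
  then show "z \<in> (\<Union>v\<in>{0, 2/3} \<times> {0, 2/3}. cylinder 1 v)"
    unfolding z(1) by blast
qed

text \<open>
  Splitting into four copies of ratio \<open>1/3\<close> multiplies the admissible diameter by \<open>3\<close> without
  raising the cost. Iterated, it shows that small covering sets are no more expensive than large
  ones, so the pre-measure is independent of \<open>\<delta>\<close> and equals the Hausdorff measure.
\<close>

lemma hausdorff_pre_measure_cantor_dust_eq: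
  assumes "0 < \<delta>" "0 < \<epsilon>"
  shows "hausdorff_pre_measure (log 3 4) \<delta> cantor_dust = hausdorff_pre_measure (log 3 4) \<epsilon> cantor_dust"
proof -
  have le: "hausdorff_pre_measure (log 3 4) \<delta> cantor_dust \<le> hausdorff_pre_measure (log 3 4) \<epsilon> cantor_dust"
    if "0 < \<delta>" for \<delta> \<epsilon> :: real
  proof -
    have step: "hausdorff_pre_measure (log 3 4) \<gamma> cantor_dust \<le> hausdorff_pre_measure (log 3 4) (3 * \<gamma>) cantor_dust" for \<gamma>
    proof -
      have "hausdorff_pre_measure (log 3 4) \<gamma> cantor_dust
          \<le> hausdorff_pre_measure (log 3 4) \<gamma> (\<Union>v\<in>{0, 2/3} \<times> {0, 2/3}. cylinder 1 v)"
        by (intro hausdorff_pre_measure_mono cantor_dust_subset_cylinders)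
      also have "\<dots> \<le> ennreal (card ({0, 2/3::real} \<times> {0, 2/3::real}) / 4 ^ 1) *
          hausdorff_pre_measure (log 3 4) (3 ^ 1 * \<gamma>) cantor_dust"
        by (rule hausdorff_pre_measure_UN_cylinders) auto
      finally show ?thesis by (simp add: card_cartesian_product)
    qed
    have "hausdorff_pre_measure (log 3 4) \<delta> cantor_dust \<le> hausdorff_pre_measure (log 3 4) (3 ^ n * \<delta>) cantor_dust" for n
    proof (induction n)
      case (Suc n)
      then show ?case
        using step[of "3 ^ n * \<delta>"] by (simp add: mult.assoc)
    qed simp
    moreover obtain n where "\<epsilon> / \<delta> < 3 ^ n"
      using real_arch_pow[of 3 "\<epsilon> / \<delta>"] by auto
    moreover from this have "\<epsilon> \<le> 3 ^ n * \<delta>"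
      using that by (simp add: field_simps)
    ultimately show ?thesis
      using hausdorff_pre_measure_antimono order_trans by blast
  qed
  show ?thesis
    using le assms by (intro antisym) auto
qed

lemma hausdorff_measure_cantor_dust:
  assumes "0 < \<delta>"
  shows "hausdorff_measure (log 3 4) cantor_dust = hausdorff_pre_measure (log 3 4) \<delta> cantor_dust"
proof (rule antisym)
  show "hausdorff_measure (log 3 4) cantor_dust \<le> hausdorff_pre_measure (log 3 4) \<delta> cantor_dust"
    unfolding hausdorff_measure_eq_SUP
    using hausdorff_pre_measure_cantor_dust_eq[OF _ assms] by (intro SUP_least) auto
qed (rule hausdorff_pre_measure_le_hausdorff_measure[OF assms])

section \<open>The octagon and the upper bound\<close>

definition cut_square :: "real \<Rightarrow> (real \<times> real) set" where
  "cut_square a = {(x, y). 0 \<le> x \<and> x \<le> 1 \<and> 0 \<le> y \<and> y \<le> 1 \<and>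
     a \<le> x + y \<and> a \<le> (1 - x) + y \<and> a \<le> x + (1 - y) \<and> a \<le> (1 - x) + (1 - y)}"

text \<open>
  Two points of the octagon differ by at most \<open>1\<close> in each coordinate and by at most \<open>2 - 2 * a\<close> in
  the sum of the coordinate distances. On the pentagon of such pairs of distances the Euclidean norm is
  maximal at the corners \<open>(1, 1 - 2 * a)\<close> and \<open>(1 - 2 * a, 1)\<close>. The bound is attained, by the
  points \<open>(a, 0)\<close> and \<open>(1 - a, 1)\<close>.
\<close>

lemma dist_cut_square_le:
  assumes a: "0 \<le> a" "a \<le> 1/2" and zw: "z \<in> cut_square a" "w \<in> cut_square a"
  shows "dist z w \<le> sqrt (1 + (1 - 2 * a)\<^sup>2)"
proof -
  obtain x y x' y' where z: "z = (x, y)" and w: "w = (x', y')" by (cases z, cases w)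
  define p where "p = \<bar>x - x'\<bar>"
  define q where "q = \<bar>y - y'\<bar>"
  have p: "0 \<le> p" "p \<le> 1" and q: "0 \<le> q" "q \<le> 1" and pq: "p + q \<le> 2 - 2 * a"
    using zw unfolding z w p_def q_def cut_square_def by (auto simp: abs_if)
  have "p\<^sup>2 + q\<^sup>2 \<le> 1 + (1 - 2 * a)\<^sup>2"
  proof (cases "q \<le> 1 - 2 * a")
    case True
    then have "q\<^sup>2 \<le> (1 - 2 * a)\<^sup>2" using q by (intro power_mono) auto
    moreover have "p\<^sup>2 \<le> 1" using p by (simp add: power_le_one)
    ultimately show ?thesis by simp
  next
    case False
    have "p\<^sup>2 \<le> (2 - 2 * a - q)\<^sup>2" using p pq by (intro power_mono) auto
    \<comment> \<open>Twice this product is the gap between the bound and \<open>(2 - 2 * a - q)\<^sup>2 + q\<^sup>2\<close>.\<close>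
    moreover have "(1 - q) * (q - (1 - 2 * a)) \<ge> 0" using False q by simp
    ultimately show ?thesis by (simp add: power2_eq_square algebra_simps)
  qed
  then show ?thesis
    by (simp add: z w dist_Pair_Pair dist_real_def p_def q_def)
qed

lemma bounded_cut_square: "bounded (cut_square a)"
proof -
  have "cut_square a \<subseteq> {0..1} \<times> {0..1}" by (auto simp: cut_square_def)
  then show ?thesis
    by (rule bounded_subset[rotated]) (intro bounded_Times bounded_closed_interval)
qed

text \<open>
  Outside the octagon one of the four corner inequalities fails, and the corner statement applies
  after reflecting one or both coordinates. The offsets \<open>26/27\<close>, \<open>224/243\<close> and \<open>242/243\<close> are the
  mirror images of the basic intervals at \<open>0\<close>, at \<open>18/243\<close> and at \<open>0\<close>.
\<close>

lemma cantor_dust_decomposition: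
  "cantor_dust \<subseteq> cut_square (20/243)
     \<union> ((\<Union>v\<in>{0, 26/27} \<times> {0, 26/27}. cylinder 3 v)
     \<union> (\<Union>v\<in>{18/243, 224/243} \<times> {0, 242/243} \<union> {0, 242/243} \<times> {18/243, 224/243}. cylinder 5 v))"
  (is "_ \<subseteq> ?O \<union> (?A \<union> ?B)")
proof
  fix z assume "z \<in> cantor_dust"
  then obtain x y where z: "z = (x, y)" and x: "x \<in> cantor_set" and y: "y \<in> cantor_set" by blast
  define flip :: "bool \<Rightarrow> real \<Rightarrow> real" where "flip s t = (if s then 1 - t else t)" for s t
  show "z \<in> ?O \<union> (?A \<union> ?B)"
  proof (cases "\<exists>s s'. flip s x + flip s' y < 20/243")
    case True
    then obtain s s' where "flip s x + flip s' y < 20/243" by blast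
    moreover have "flip s x \<in> cantor_set" "flip s' y \<in> cantor_set"
      using x y cantor_set_symmetric by (auto simp: flip_def)
    ultimately have *: "27 * flip s x \<in> cantor_set \<and> 27 * flip s' y \<in> cantor_set
      \<or> 243 * flip s x - 18 \<in> cantor_set \<and> 243 * flip s' y \<in> cantor_set
      \<or> 243 * flip s x \<in> cantor_set \<and> 243 * flip s' y - 18 \<in> cantor_set"
      by (intro cantor_corner)
    have A: "\<exists>a\<in>{0, 26/27}. 3 ^ 3 * (t - a) \<in> cantor_set" if "27 * flip s t \<in> cantor_set" for s t
      using that cantor_set_symmetric[of "27 * flip s t"] unfolding bex_simps by (cases s) (auto simp: flip_def algebra_simps)
    have B: "\<exists>a\<in>{18/243, 224/243}. 3 ^ 5 * (t - a) \<in> cantor_set" if "243 * flip s t - 18 \<in> cantor_set" for s t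
      using that cantor_set_symmetric[of "243 * flip s t - 18"] unfolding bex_simps by (cases s) (auto simp: flip_def algebra_simps)
    have C: "\<exists>a\<in>{0, 242/243}. 3 ^ 5 * (t - a) \<in> cantor_set" if "243 * flip s t \<in> cantor_set" for s t
      using that cantor_set_symmetric[of "243 * flip s t"] unfolding bex_simps by (cases s) (auto simp: flip_def algebra_simps)
    from * consider
      "27 * flip s x \<in> cantor_set" "27 * flip s' y \<in> cantor_set"
      | "243 * flip s x - 18 \<in> cantor_set" "243 * flip s' y \<in> cantor_set"
      | "243 * flip s x \<in> cantor_set" "243 * flip s' y - 18 \<in> cantor_set" by blast
    then have "z \<in> ?A \<or> z \<in> ?B"
    proof cases
      case 1
      then obtain a b where "a \<in> {0, 26/27}" "b \<in> {0, 26/27}" "(x, y) \<in> cylinder 3 (a, b)"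
        using A mem_cylinderI by meson
      then show ?thesis unfolding z by blast
    next
      case 2
      then obtain a b where "a \<in> {18/243, 224/243}" "b \<in> {0, 242/243}" "(x, y) \<in> cylinder 5 (a, b)"
        using B C mem_cylinderI by meson
      then show ?thesis unfolding z by blast
    next
      case 3
      then obtain a b where "a \<in> {0, 242/243}" "b \<in> {18/243, 224/243}" "(x, y) \<in> cylinder 5 (a, b)"
        using B C mem_cylinderI by meson
      then show ?thesis unfolding z by blast
    qed
    then show ?thesis by blast
  next
    case False
    then have "20/243 \<le> flip s x + flip s' y" for s s' by (simp add: not_less)
    from this[of False False] this[of False True] this[of True False] this[of True True]
    have "z \<in> ?O"
      using cantor_set_bounds[OF x] cantor_set_bounds[OF y] by (simp add: z cut_square_def flip_def)
    then show ?thesis by blast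
  qed
qed

lemma power_powr: "0 < x \<Longrightarrow> (x ^ n) powr y = x powr (real n * y)" for x :: real
  by (simp add: powr_powr flip: powr_realpow)

text \<open>
  The fraction \<open>12/19\<close> is a convergent of the continued fraction of \<open>log 3 2\<close>; the cruder
  \<open>2/3\<close> would not suffice for the numerical bound below.
\<close>

lemma log_3_2_le: "log 3 2 \<le> 12/19"
proof -
  have "log 3 (2 ^ 19) \<le> log 3 (3 ^ 12 :: real)"
    by (subst log_le_cancel_iff) simp_all
  then show ?thesis
    by (simp only: log_nat_power) simp
qed

text \<open>
  Since \<open>log 3 4 = 2 * log 3 2\<close>, the square root disappears, and the rational bound on the exponent
  reduces the claim to an inequality between a twelfth and a nineteenth power of rationals.
\<close>

lemma cut_square_cost:
  "sqrt (1 + (1 - 2 * (20/243))\<^sup>2) powr log 3 4 \<le> 1.3972"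
proof -
  define D :: real where "D = 1 + (1 - 2 * (20/243))\<^sup>2"
  have D: "1 \<le> D" "D \<le> 1.69788"
    by (simp_all add: D_def power2_eq_square)
  have "sqrt D powr log 3 4 = (D powr (1/2)) powr (2 * log 3 2)"
    using log_nat_power[of 2 3 2] D by (simp add: powr_half_sqrt)
  also have "\<dots> = D powr log 3 2"
    by (simp add: powr_powr)
  also have "\<dots> \<le> D powr (12/19)"
    using log_3_2_le D by (intro powr_mono) auto
  also have "\<dots> = (D ^ 12) powr (1/19)"
    using D by (simp add: power_powr)
  also have "\<dots> \<le> (1.3972 ^ 19) powr (1/19)"
  proof (intro powr_mono2)
    have "D ^ 12 \<le> 1.69788 ^ 12"
      using D by (intro power_mono) auto
    also have "\<dots> \<le> (1.3972 ^ 19 :: real)"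
      by (simp add: power_divide)
    finally show "D ^ 12 \<le> 1.3972 ^ 19" .
  qed (use D in auto)
  also have "\<dots> = 1.3972"
    by (subst power_powr) simp_all
  finally show ?thesis by (simp only: D_def)
qed

text \<open>
  The four cylinders of level 3 carry \<open>4/64 = 1/16\<close> of the cost of the whole set and the eight of level
  5 carry \<open>8/1024 = 1/128\<close>, so the pre-measure \<open>h\<close> satisfies
  \<open>h \<le> 1.3972 + (1/16 + 1/128) * h\<close>. Being finite, it is at most \<open>1.3972 * 128/119 < 1.502878\<close>.
\<close>

lemma hausdorff_measure_cantor_dust_le:
  "hausdorff_measure (log 3 4) cantor_dust \<le> ennreal 1.502878"
proof -
  have s: "0 < log 3 (4::real)" by simp
  let ?H = "hausdorff_pre_measure (log 3 4)" and ?O = "cut_square (20/243)"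
  let ?A = "\<Union>v\<in>{0, 26/27} \<times> {0, 26/27}. cylinder 3 v"
  let ?B = "\<Union>v\<in>{18/243, 224/243} \<times> {0, 242/243} \<union> {0, 242/243} \<times> {18/243, 224/243}. cylinder 5 v"
  let ?h = "?H 2 cantor_dust"
  have d_le: "diameter ?O \<le> sqrt (1 + (1 - 2 * (20/243))\<^sup>2)"
  proof (rule diameter_le)
    fix z w assume "z \<in> ?O" "w \<in> ?O"
    from dist_cut_square_le[OF _ _ this] show "norm (z - w) \<le> sqrt (1 + (1 - 2 * (20/243))\<^sup>2)"
      unfolding dist_norm by simp
  qed simp
  have "sqrt (1 + (1 - 2 * (20/243))\<^sup>2) \<le> (2::real)"
    by (intro real_le_lsqrt) (simp_all add: field_simps)
  with d_le have d2: "diameter ?O \<le> 2" by linarith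
  have "dist (1/2 :: real, 0 :: real) (1/2, 1) \<le> diameter ?O"
    by (intro diameter_bounded_bound[OF bounded_cut_square]) (auto simp: cut_square_def)
  then have d0: "0 < diameter ?O"
    by (simp add: dist_Pair_Pair)
  have "?H 2 ?O \<le> ennreal (diameter ?O powr log 3 4)"
    using bounded_cut_square d0 d2 s by (rule hausdorff_pre_measure_le_diameter)
  also have "\<dots> \<le> ennreal 1.3972"
    using powr_mono2[OF _ _ d_le, of "log 3 4"] d0 cut_square_cost by (intro ennreal_leI) auto
  finally have O: "?H 2 ?O \<le> ennreal 1.3972" .
  have A: "?H 2 ?A \<le> ennreal (1/16) * ?h"
    using hausdorff_pre_measure_UN_cylinders[of "{0, 26/27} \<times> {0, 26/27}" 2 3]
      hausdorff_pre_measure_cantor_dust_eq[of 54 2] by (simp add: card_cartesian_product)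
  have B: "?H 2 ?B \<le> ennreal (1/128) * ?h"
    using hausdorff_pre_measure_UN_cylinders[of
        "{18/243, 224/243} \<times> {0, 242/243} \<union> {0, 242/243} \<times> {18/243, 224/243}" 2 5]
      hausdorff_pre_measure_cantor_dust_eq[of 486 2] by (simp add: card_cartesian_product card_Un_disjoint)
  have "?h \<le> ?H 2 (?O \<union> (?A \<union> ?B))"
    by (intro hausdorff_pre_measure_mono cantor_dust_decomposition)
  also have "\<dots> \<le> ?H 2 ?O + (?H 2 ?A + ?H 2 ?B)"
    by (intro order_trans[OF hausdorff_pre_measure_Un] add_left_mono hausdorff_pre_measure_Un)
  also have "\<dots> \<le> ennreal 1.3972 + (ennreal (1/16) * ?h + ennreal (1/128) * ?h)"
    using O A B by (intro add_mono)
  finally have rec: "?h \<le> ennreal 1.3972 + (ennreal (1/16) * ?h + ennreal (1/128) * ?h)" .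
  \<comment> \<open>The recursive inequality is vacuous for an infinite \<open>h\<close>.\<close>
  have "?h \<noteq> top"
  proof -
    have "cantor_dust \<subseteq> cut_square 0"
    proof
      fix z assume "z \<in> cantor_dust"
      then obtain x y where "z = (x, y)" "x \<in> cantor_set" "y \<in> cantor_set" by blast
      then show "z \<in> cut_square 0"
        using cantor_set_bounds[of x] cantor_set_bounds[of y] by (simp add: cut_square_def)
    qed
    then have "?h \<le> ?H 2 (cut_square 0)" by (rule hausdorff_pre_measure_mono)
    also have "\<dots> \<le> ennreal (diameter (cut_square 0) powr log 3 4)"
    proof (rule hausdorff_pre_measure_le_diameter[OF bounded_cut_square _ _ s])
      have "dist (1/2 :: real, 0 :: real) (1/2, 1) \<le> diameter (cut_square 0)"
        by (intro diameter_bounded_bound[OF bounded_cut_square]) (auto simp: cut_square_def)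
      then show "0 < diameter (cut_square 0)" by (simp add: dist_Pair_Pair)
      have "sqrt 2 \<le> (2::real)" by (intro real_le_lsqrt) simp_all
      then have "norm (z - w) \<le> 2" if "z \<in> cut_square 0" "w \<in> cut_square 0" for z w
        using dist_cut_square_le[OF _ _ that] by (simp add: dist_norm)
      then show "diameter (cut_square 0) \<le> 2"
        by (intro diameter_le) auto
    qed
    also have "\<dots> < top" by simp
    finally show ?thesis by simp
  qed
  then obtain r where r: "0 \<le> r" "?h = ennreal r"
    by (cases ?h) auto
  have "r \<le> 1.3972 + (1/16 * r + 1/128 * r)"
    using rec r(1) unfolding r(2) by (simp flip: ennreal_mult ennreal_plus)
  then have "r \<le> 1.502878" by simp
  then show ?thesis
    using hausdorff_measure_cantor_dust[of 2] r(2) ennreal_leI by simp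
qed

section \<open>An inverse of the Cantor function and the lower bound\<close>

text \<open>
  Binary digits are read as ternary digits \<open>0\<close> and \<open>2\<close>: a section of the Cantor function. Taken
  modulo \<open>2\<close>, the digits make the function periodic on the whole line, which avoids a case
  distinction in its functional equation.
\<close>

definition cantor_inverse :: "real \<Rightarrow> real" where
  "cantor_inverse x = (\<Sum>n. 2 * real_of_int (\<lfloor>2 ^ Suc n * x\<rfloor> mod 2) / 3 ^ Suc n)"

lemma cantor_inverse_summable:
  "summable (\<lambda>n. 2 * real_of_int (\<lfloor>2 ^ Suc n * x\<rfloor> mod 2) / 3 ^ Suc n)"
proof (rule summable_comparison_test')
  show "summable (\<lambda>n. 2 * (1/3) ^ Suc n :: real)"
    by (intro summable_mult) simp
  show "norm (2 * real_of_int (\<lfloor>2 ^ Suc n * x\<rfloor> mod 2) / 3 ^ Suc n) \<le> 2 * (1/3) ^ Suc n" for n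
  proof -
    have "\<lfloor>2 ^ Suc n * x\<rfloor> mod 2 \<in> {0, 1}" by auto
    then show ?thesis by (auto simp: power_divide)
  qed
qed

lemma cantor_inverse_double:
  "cantor_inverse x = (2 * real_of_int (\<lfloor>2 * x\<rfloor> mod 2) + cantor_inverse (2 * x)) / 3"
proof -
  let ?f = "\<lambda>x n. 2 * real_of_int (\<lfloor>2 ^ Suc n * x\<rfloor> mod 2) / 3 ^ Suc n"
  have "cantor_inverse x = ?f x 0 + (\<Sum>n. ?f x (Suc n))"
    unfolding cantor_inverse_def using suminf_split_head[OF cantor_inverse_summable, of x] by linarith
  also have "(\<Sum>n. ?f x (Suc n)) = (\<Sum>n. ?f (2 * x) n / 3)"
    by (simp add: mult_ac)
  also have "\<dots> = cantor_inverse (2 * x) / 3"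
    unfolding cantor_inverse_def by (rule suminf_divide[OF cantor_inverse_summable])
  finally show ?thesis by (simp add: add_divide_distrib)
qed

lemma cantor_inverse_periodic: "cantor_inverse (x - 1) = cantor_inverse x"
proof -
  have "\<lfloor>2 ^ Suc n * (x - 1)\<rfloor> mod 2 = \<lfloor>2 ^ Suc n * x\<rfloor> mod 2" for n
  proof -
    have "2 ^ Suc n * (x - 1) = 2 ^ Suc n * x - of_int (2 * 2 ^ n)"
      by (simp add: algebra_simps)
    then have "\<lfloor>2 ^ Suc n * (x - 1)\<rfloor> = \<lfloor>2 ^ Suc n * x\<rfloor> - 2 * 2 ^ n"
      by (simp only: floor_diff_of_int)
    then show ?thesis
      by (metis mod_mult_self4 add_diff_cancel_left' diff_add_cancel mod_mult_self2)
  qed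
  then show ?thesis by (simp only: cantor_inverse_def)
qed

lemma cantor_inverse_lower_half:
  "0 \<le> x \<Longrightarrow> x < 1/2 \<Longrightarrow> cantor_inverse x = cantor_inverse (2 * x) / 3"
proof -
  assume "0 \<le> x" "x < 1/2"
  then have "\<lfloor>2 * x\<rfloor> = 0" by (simp add: floor_eq_iff)
  then show ?thesis using cantor_inverse_double[of x] by simp
qed

lemma cantor_inverse_upper_half:
  "1/2 \<le> x \<Longrightarrow> x < 1 \<Longrightarrow> cantor_inverse x = (cantor_inverse (2 * x - 1) + 2) / 3"
proof -
  assume "1/2 \<le> x" "x < 1"
  then have "\<lfloor>2 * x\<rfloor> = 1" by (simp add: floor_eq_iff)
  then show ?thesis
    using cantor_inverse_double[of x] cantor_inverse_periodic[of "2 * x"] by simp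
qed

lemma cantor_inverse_bounds: "0 \<le> cantor_inverse x" "cantor_inverse x \<le> 1"
proof -
  have d: "\<lfloor>2 ^ Suc n * x\<rfloor> mod 2 \<in> {0, 1}" for n by auto
  show "0 \<le> cantor_inverse x"
    unfolding cantor_inverse_def using cantor_inverse_summable by (intro suminf_nonneg) auto
  have s: "(\<lambda>n. 2 / 3 * (1/3) ^ n :: real) sums (2 / 3 * (1 / (1 - 1/3)))"
    by (intro sums_mult geometric_sums) simp
  have "cantor_inverse x \<le> (\<Sum>n. 2 / 3 * (1/3) ^ n)"
    unfolding cantor_inverse_def
  proof (rule suminf_le[OF _ cantor_inverse_summable sums_summable[OF s]])
    show "2 * real_of_int (\<lfloor>2 ^ Suc n * x\<rfloor> mod 2) / 3 ^ Suc n \<le> 2 / 3 * (1 / 3) ^ n" for n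
      using d[of n] by (auto simp: power_divide)
  qed
  then show "cantor_inverse x \<le> 1"
    using sums_unique[OF s] by simp
qed

text \<open>
  By the functional equation the value at \<open>x\<close> is obtained from the value at another point by one of the
  two contractions, so it is within \<open>(1/3) ^ n\<close> of the Cantor set for every \<open>n\<close>.
\<close>

lemma cantor_inverse_in_cantor_set:
  assumes "0 \<le> x" "x < 1"
  shows "cantor_inverse x \<in> cantor_set"
proof -
  have cl: "closed cantor_set" using compact_cantor_set by (rule compact_imp_closed)
  have "\<exists>c\<in>cantor_set. \<bar>cantor_inverse x - c\<bar> \<le> (1/3) ^ n" if "0 \<le> x" "x < 1" for n x
    using that
  proof (induction n arbitrary: x)
    case 0
    obtain c where c: "c \<in> cantor_set" using cantor_set_nonempty by blast
    then show ?case
      using cantor_set_bounds[OF c] cantor_inverse_bounds[of x] by (intro bexI[of _ c]) (auto simp: abs_le_iff)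
  next
    case (Suc n)
    show ?case
    proof (cases "x < 1/2")
      case True
      then obtain c where c: "c \<in> cantor_set" "\<bar>cantor_inverse (2 * x) - c\<bar> \<le> (1/3) ^ n"
        using Suc.IH[of "2 * x"] Suc.prems by auto
      have "cantor_inverse x - c / 3 = (cantor_inverse (2 * x) - c) / 3"
        using True Suc.prems by (simp add: cantor_inverse_lower_half diff_divide_distrib)
      then have "\<bar>cantor_inverse x - c / 3\<bar> \<le> (1/3) ^ Suc n"
        using c(2) by (simp only: abs_divide) simp
      then show ?thesis
        using cantor_set_thirdI(1)[OF c(1)] by blast
    next
      case False
      then obtain c where c: "c \<in> cantor_set" "\<bar>cantor_inverse (2 * x - 1) - c\<bar> \<le> (1/3) ^ n"
        using Suc.IH[of "2 * x - 1"] Suc.prems by auto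
      have "cantor_inverse x - (c + 2) / 3 = (cantor_inverse (2 * x - 1) - c) / 3"
        using False Suc.prems by (simp add: cantor_inverse_upper_half diff_divide_distrib add_divide_distrib)
      then have "\<bar>cantor_inverse x - (c + 2) / 3\<bar> \<le> (1/3) ^ Suc n"
        using c(2) by (simp only: abs_divide) simp
      then show ?thesis
        using cantor_set_thirdI(2)[OF c(1)] by blast
    qed
  qed
  moreover have "\<exists>n. (1/3) ^ n < e" if "0 < e" for e :: real
    using real_arch_pow_inv[OF that, of "1/3"] by simp
  ultimately have "\<exists>c\<in>cantor_set. dist c (cantor_inverse x) < e" if "0 < e" for e
    using assms that unfolding dist_real_def by (metis abs_minus_commute order_le_less_trans)
  then have "cantor_inverse x \<in> closure cantor_set"
    by (simp add: closure_approachable)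
  then show ?thesis using cl by simp
qed

text \<open>
  If \<open>x\<close> and \<open>y\<close> lie in different halves of the unit interval, their images are separated by the
  middle third; otherwise both are rescaled by the same affine map.
\<close>

lemma cantor_inverse_separates:
  assumes "0 \<le> x" "x < 1" "0 \<le> y" "y < 1" "(1/2) ^ n < \<bar>x - y\<bar>"
  shows "(1/3) ^ n \<le> \<bar>cantor_inverse x - cantor_inverse y\<bar>"
  using assms
proof (induction n arbitrary: x y)
  case 0
  then show ?case by (auto simp: abs_if split: if_splits)
next
  case (Suc n)
  have cross: "1/3 \<le> cantor_inverse v - cantor_inverse u" if "0 \<le> u" "u < 1/2" "1/2 \<le> v" "v < 1" for u v
  proof -
    have "cantor_inverse u \<le> 1/3"
      unfolding cantor_inverse_lower_half[OF that(1,2)]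
      using cantor_inverse_bounds(2)[of "2 * u"] by simp
    moreover have "2/3 \<le> cantor_inverse v"
      unfolding cantor_inverse_upper_half[OF that(3,4)]
      using cantor_inverse_bounds(1)[of "2 * v - 1"] by simp
    ultimately show ?thesis by linarith
  qed
  have small: "(1/3::real) ^ Suc n \<le> 1/3"
    using power_decreasing[of 1 "Suc n" "1/3::real"] by simp
  consider "x < 1/2" "y < 1/2" | "1/2 \<le> x" "1/2 \<le> y" | "x < 1/2" "1/2 \<le> y" | "1/2 \<le> x" "y < 1/2"
    by linarith
  then show ?case
  proof cases
    case 1
    have "(1/2) ^ n < \<bar>2 * x - 2 * y\<bar>" using Suc.prems by (simp add: abs_if split: if_splits)
    then have "(1/3) ^ n \<le> \<bar>cantor_inverse (2 * x) - cantor_inverse (2 * y)\<bar>"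
      using 1 Suc.prems by (intro Suc.IH) auto
    then show ?thesis using 1 Suc.prems by (simp add: cantor_inverse_lower_half flip: diff_divide_distrib)
  next
    case 2
    have "(1/2) ^ n < \<bar>(2 * x - 1) - (2 * y - 1)\<bar>" using Suc.prems by (simp add: abs_if split: if_splits)
    then have "(1/3) ^ n \<le> \<bar>cantor_inverse (2 * x - 1) - cantor_inverse (2 * y - 1)\<bar>"
      using 2 Suc.prems by (intro Suc.IH) auto
    then show ?thesis using 2 Suc.prems by (simp add: cantor_inverse_upper_half flip: diff_divide_distrib)
  next
    case 3
    then show ?thesis using cross[of x y] Suc.prems small by linarith
  next
    case 4
    then show ?thesis using cross[of y x] Suc.prems small by linarith
  qed
qed

text \<open>
  Inverse form of the fact that the Cantor function is Hoelder continuous with exponent \<open>log 3 2\<close>.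
  The factor \<open>2\<close> is lost in comparing \<open>\<bar>x - y\<bar>\<close> with the nearest power of \<open>1/2\<close>.
\<close>

lemma cantor_inverse_expands:
  assumes "0 \<le> x" "x < 1" "0 \<le> y" "y < 1"
  shows "\<bar>x - y\<bar> \<le> 2 * \<bar>cantor_inverse x - cantor_inverse y\<bar> powr log 3 2"
proof (cases "x = y")
  case False
  have ex: "\<exists>n. (1/2) ^ n < \<bar>x - y\<bar>"
    using False real_arch_pow_inv[of "\<bar>x - y\<bar>" "1/2"] by simp
  define n where "n = (LEAST n. (1/2) ^ n < \<bar>x - y\<bar>)"
  have n: "(1/2) ^ n < \<bar>x - y\<bar>"
    unfolding n_def using ex by (rule LeastI_ex)
  have "n \<noteq> 0"
  proof
    assume "n = 0"
    then show False using n assms by (simp add: abs_if split: if_splits)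
  qed
  then obtain m where m: "n = Suc m" by (cases n) auto
  then have "\<not> (1/2) ^ m < \<bar>x - y\<bar>"
    using not_less_Least[of m "\<lambda>n. (1/2) ^ n < \<bar>x - y\<bar>"] unfolding n_def by simp
  then have "\<bar>x - y\<bar> \<le> 2 * (1/2) ^ n"
    by (simp add: m)
  also have "(1/2) ^ n = ((1/3::real) ^ n) powr log 3 2"
  proof -
    have "((1/3::real) ^ n) powr log 3 2 = ((1/3) powr log 3 2) ^ n"
      by (simp add: power_powr powr_power mult.commute)
    then show ?thesis by (simp add: powr_divide)
  qed
  also have "\<dots> \<le> \<bar>cantor_inverse x - cantor_inverse y\<bar> powr log 3 2"
    using cantor_inverse_separates[OF assms n] by (intro powr_mono2) auto
  finally show ?thesis by simp
qed simp

lemma emeasure_lborel_square: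
  assumes "0 \<le> r"
  shows "emeasure lborel (cbox (x - r, y - r) (x + r, y + r :: real)) = ennreal ((2 * r)\<^sup>2)"
proof -
  have "emeasure lborel (cbox (x - r, y - r) (x + r, y + r))
      = (\<Prod>b\<in>Basis. ((x + r, y + r) - (x - r, y - r)) \<bullet> b)"
    by (rule emeasure_lborel_cbox) (use assms in \<open>auto simp: Basis_prod_def\<close>)
  also have "\<dots> = ennreal ((2 * r)\<^sup>2)"
    by (simp add: Basis_prod_def prod.union_disjoint power2_eq_square)
  finally show ?thesis .
qed

text \<open>
  Pulling a cover back along the inverse Cantor function in both coordinates covers the open unit
  square. The preimage of a set of diameter \<open>d\<close> lies in a square of side \<open>4 * d powr log 3 2\<close>, whose
  area is \<open>16 * d powr log 3 4\<close>; the areas add up to at least \<open>1\<close>.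
\<close>

lemma hausdorff_pre_measure_cantor_dust_ge:
  "ennreal 1 \<le> ennreal 16 * hausdorff_pre_measure (log 3 4) \<delta> cantor_dust"
proof (rule le_cmult_hausdorff_pre_measureI)
  fix U assume U: "delta_cover \<delta> cantor_dust U"
  define V where "V i = {(x, y). 0 \<le> x \<and> x < 1 \<and> 0 \<le> y \<and> y < 1 \<and> (cantor_inverse x, cantor_inverse y) \<in> U i}" for i
  define r where "r i = 2 * diameter (U i) powr log 3 2" for i
  \<comment> \<open>The preimages need not be measurable, so they are enclosed in squares.\<close>
  have cov: "\<exists>B. V i \<subseteq> B \<and> B \<in> sets lborel \<and> emeasure lborel B \<le> ennreal ((2 * r i)\<^sup>2)" for i
  proof (cases "V i = {}")
    case False
    then obtain x y where p: "(x, y) \<in> V i" by auto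
    have bnd: "bounded (U i)" using U unfolding delta_cover_def by blast
    have "\<bar>x' - x\<bar> \<le> r i \<and> \<bar>y' - y\<bar> \<le> r i" if q: "(x', y') \<in> V i" for x' y'
    proof -
      have d: "dist (cantor_inverse x', cantor_inverse y') (cantor_inverse x, cantor_inverse y) \<le> diameter (U i)"
        using p q unfolding V_def by (intro diameter_bounded_bound[OF bnd]) auto
      have "\<bar>cantor_inverse x' - cantor_inverse x\<bar> \<le> diameter (U i)"
        using d dist_fst_le[of "(cantor_inverse x', cantor_inverse y')" "(cantor_inverse x, cantor_inverse y)"]
        by (simp add: dist_real_def)
      moreover have "\<bar>cantor_inverse y' - cantor_inverse y\<bar> \<le> diameter (U i)"
        using d dist_snd_le[of "(cantor_inverse x', cantor_inverse y')" "(cantor_inverse x, cantor_inverse y)"]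
        by (simp add: dist_real_def)
      ultimately have "\<bar>cantor_inverse x' - cantor_inverse x\<bar> powr log 3 2 \<le> diameter (U i) powr log 3 2"
        "\<bar>cantor_inverse y' - cantor_inverse y\<bar> powr log 3 2 \<le> diameter (U i) powr log 3 2"
        by (auto intro!: powr_mono2)
      then show ?thesis
        using cantor_inverse_expands[of x' x] cantor_inverse_expands[of y' y] p q
        unfolding V_def r_def by auto
    qed
    then have "V i \<subseteq> cbox (x - r i, y - r i) (x + r i, y + r i)"
      by (fastforce simp: mem_box Basis_prod_def abs_le_iff)
    moreover have "0 \<le> r i" by (simp add: r_def)
    ultimately show ?thesis
      using emeasure_lborel_square[of "r i" x y] by (intro exI[of _ "cbox (x - r i, y - r i) (x + r i, y + r i)"]) auto
  qed (auto intro!: exI[of _ "{}"])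
  then obtain B where B: "\<And>i. V i \<subseteq> B i" "\<And>i. B i \<in> sets lborel"
    "\<And>i. emeasure lborel (B i) \<le> ennreal ((2 * r i)\<^sup>2)"
    by metis
  have "ennreal 1 = emeasure lborel (cbox (1/2 - 1/2 :: real, 1/2 - 1/2 :: real) (1/2 + 1/2, 1/2 + 1/2))"
    by (subst emeasure_lborel_square) auto
  also have "\<dots> = emeasure lborel (box (0 :: real, 0 :: real) (1, 1))"
    by (simp add: emeasure_lborel_box_eq emeasure_lborel_cbox_eq)
  also have "\<dots> \<le> emeasure lborel (\<Union>i. B i)"
  proof (intro emeasure_mono subsetI)
    fix z assume "z \<in> box (0 :: real, 0 :: real) (1, 1)"
    then obtain x y where z: "z = (x, y)" "0 < x" "x < 1" "0 < y" "y < 1"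
      by (cases z) (auto simp: mem_box Basis_prod_def)
    then have "(cantor_inverse x, cantor_inverse y) \<in> cantor_dust"
      by (simp add: cantor_inverse_in_cantor_set)
    then obtain i where "(cantor_inverse x, cantor_inverse y) \<in> U i"
      using U unfolding delta_cover_def by blast
    then have "z \<in> V i" using z by (simp add: V_def)
    then show "z \<in> (\<Union>i. B i)" using B(1) by blast
  qed (use B(2) in auto)
  also have "\<dots> \<le> (\<Sum>i. emeasure lborel (B i))"
    using B(2) by (intro emeasure_subadditive_countably) auto
  also have "\<dots> \<le> (\<Sum>i. ennreal 16 * ennreal (diameter (U i) powr log 3 4))"
  proof (intro suminf_le)
    fix i
    have "(2 * r i)\<^sup>2 = 16 * (diameter (U i) powr log 3 2)\<^sup>2"
      by (simp add: r_def power2_eq_square)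
    also have "(diameter (U i) powr log 3 2)\<^sup>2 = diameter (U i) powr log 3 4"
      using log_nat_power[of 2 3 2] by (simp add: power2_eq_square flip: powr_add)
    finally have eq: "(2 * r i)\<^sup>2 = 16 * diameter (U i) powr log 3 4" .
    show "emeasure lborel (B i) \<le> ennreal 16 * ennreal (diameter (U i) powr log 3 4)"
      using B(3)[of i] unfolding eq by (simp add: ennreal_mult)
  qed auto
  finally show "ennreal 1 \<le> ennreal 16 * (\<Sum>i. ennreal (diameter (U i) powr log 3 4))"
    by simp
qed simp

theorem theorem2:
  shows "hausdorff_dim (cantor_set \<times> cantor_set) = ereal (log 3 4) \<and>
         hausdorff_measure (log 3 4) (cantor_set \<times> cantor_set) \<le> ennreal 1.502878"
proof
  show "hausdorff_dim (cantor_set \<times> cantor_set) = ereal (log 3 4)"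
  proof (rule hausdorff_dim_eqI)
    have "hausdorff_pre_measure (log 3 4) 1 cantor_dust \<noteq> 0"
      using hausdorff_pre_measure_cantor_dust_ge[of 1] by auto
    then show "0 < hausdorff_measure (log 3 4) cantor_dust"
      using hausdorff_measure_cantor_dust[of 1] by (simp add: zero_less_iff_neq_zero)
    show "hausdorff_measure (log 3 4) cantor_dust < top"
      using hausdorff_measure_cantor_dust_le by (rule order_le_less_trans) simp
  qed simp
qed (rule hausdorff_measure_cantor_dust_le)

end
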